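(* Let $A\in\mathbb{R}^{n\times n}$ be symmetric positive definite, let $\{1,\dots,n\}=\mathcal{F}\cup\mathcal{A}$ be a partition into disjoint sets with $\mathcal{F}$ nonempty, let $P_{\mathcal{F}}\in\mathbb{R}^{n\times n}$ be the diagonal matrix with $(P_{\mathcal{F}})_{ii}=1$ for $i\in\mathcal{F}$ and $(P_{\mathcal{F}})_{ii}=0$ for $i\in\mathcal{A}$, and let $M^{-1}:=P_{\mathcal{F}}A^{-1}P_{\mathcal{F}}$. Then $$\kappa_{eff}\left(M^{-1}A\right)\le\frac{\left(\kappa(A)+1\right)^2}{4\kappa(A)}.$$
   Context: $\kappa(A)=\lambda_{\max}(A)/\lambda_{\min}(A)$ is the spectral condition number of $A$. The matrix $M^{-1}A$ has real nonnegative eigenvalues, and $\kappa_{eff}(M^{-1}A)$ denotes its effective condition number: the ratio of its largest eigenvalue to its smallest non-zero eigenvalue. The symbol $M^{-1}$ is only a name for the (singular in general) matrix $P_{\mathcal{F}}A^{-1}P_{\mathcal{F}}$ (the approximate preconditioner in face with the exact inverse of $A$ as inner preconditioner); it is not the inverse of a matrix. *)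

theory Defs
  imports
    "Jordan_Normal_Form.Gauss_Jordan_Elimination"
    "Jordan_Normal_Form.Spectral_Radius"
begin

definition pos_def_mat :: "real mat \<Rightarrow> bool" where
  "pos_def_mat A \<longleftrightarrow>
     square_mat A \<and>
     (\<forall>v \<in> carrier_vec (dim_row A). v \<noteq> 0\<^sub>v (dim_row A) \<longrightarrow> v \<bullet> (A *\<^sub>v v) > 0)"

definition spectral_cond :: "real mat \<Rightarrow> real" where
  "spectral_cond A = Max (spectrum A) / Min (spectrum A)"

text \<open>Meant for square matrices all of whose (complex) eigenvalues are real and nonnegative and
  not all zero; for these, \<open>spectrum B\<close>, the set of real eigenvalues, is the whole spectrum.
  The spectrum of a square matrix over a field is finite.\<close>

definition eff_cond :: "real mat \<Rightarrow> real" where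
  "eff_cond B = Max (spectrum B) / Min (spectrum B - {0})"

definition coord_proj :: "nat \<Rightarrow> nat set \<Rightarrow> real mat" where
  "coord_proj n F = mat_diag n (\<lambda>i. if i \<in> F then 1 else 0)"

text \<open>\<open>mat_inverse A\<close> is \<open>Some\<close> of the two-sided inverse of \<open>A\<close> whenever \<open>A\<close> is invertible,
  in particular whenever \<open>A\<close> is positive definite.\<close>

definition face_precond :: "nat \<Rightarrow> nat set \<Rightarrow> real mat \<Rightarrow> real mat" where
  "face_precond n F A = coord_proj n F * the (mat_inverse A) * coord_proj n F"

end

theory Submission
  imports Defs
begin

text \<open>Let \<open>v\<close> be an eigenvector of \<open>P A\<^sup>-\<^sup>1 P A\<close> for \<open>\<lambda> \<noteq> 0\<close>, so that \<open>P v = v\<close>, and put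
  \<open>u = P A v\<close>, \<open>x = A\<^sup>-\<^sup>1 u\<close> and \<open>q = v \<bullet> A v\<close>. Then \<open>x \<bullet> A x = \<lambda> q\<close> and \<open>x \<bullet> A v = q\<close>, so
  Cauchy-Schwarz in the inner product of \<open>A\<close> gives \<open>\<lambda> \<ge> 1\<close>. If the spectrum of \<open>A\<close> lies in \<open>[m, M]\<close>,
  then \<open>(M - A) (A - m) A \<ge> 0\<close> gives
  \<open>m M \<lambda> q \<le> (m + M) (u \<bullet> u) - u \<bullet> A u\<close>, and the right-hand side is at most
  \<open>((m + M) / 2)\<^sup>2 q\<close> because \<open>A\<close> is nonnegative at \<open>u - ((m + M) / 2) v\<close>. Hence
  \<open>\<lambda> \<le> (m + M)\<^sup>2 / (4 m M)\<close>.\<close>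

section \<open>Spectral theorem for real symmetric matrices\<close>

lemma symmetric_scalar_prod:
  fixes A :: "'a :: comm_semiring_0 mat"
  assumes "A \<in> carrier_mat n n" "A\<^sup>T = A" "x \<in> carrier_vec n" "y \<in> carrier_vec n"
  shows "(A *\<^sub>v x) \<bullet> y = x \<bullet> (A *\<^sub>v y)"
  using transpose_vec_mult_scalar[OF assms(1,4,3)] assms(2) by simp

text \<open>The complexified matrix has some eigenvalue \<open>c\<close>. Pairing an eigenvector
  with its conjugate and moving the matrix across by symmetry forces \<open>c = cnj c\<close>,
  because \<open>v \<bullet>c v\<close> is nonzero.\<close>

lemma symmetric_has_real_eigenvalue:
  fixes A :: "real mat"
  assumes A: "A \<in> carrier_mat n n" and sym: "A\<^sup>T = A" and n: "n > 0"
  shows "\<exists>e. eigenvalue A e"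
proof -
  let ?B = "map_mat complex_of_real A"
  have B: "?B \<in> carrier_mat n n" using A by simp
  have Bsym: "?B\<^sup>T = ?B" using A arg_cong[OF sym, of "map_mat complex_of_real"] by (auto intro!: eq_matI simp: mat_eq_iff)
  obtain c where c: "eigenvalue ?B c"
    using spectrum_non_empty[OF B n] by (auto simp: spectrum_def)
  then obtain v where v: "v \<in> carrier_vec n" "v \<noteq> 0\<^sub>v n" and Bv: "?B *\<^sub>v v = c \<cdot>\<^sub>v v"
    unfolding eigenvalue_def eigenvector_def using B by auto
  have cv: "conjugate v \<in> carrier_vec n" using v by simp
  have "conjugate (?B *\<^sub>v v) = ?B *\<^sub>v conjugate v"
    using A v by (intro eq_vecI) (auto simp: scalar_prod_def)
  then have Bcv: "?B *\<^sub>v conjugate v = cnj c \<cdot>\<^sub>v conjugate v"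
    by (simp add: Bv conjugate_smult_vec)
  have "c * (v \<bullet>c v) = (?B *\<^sub>v v) \<bullet> conjugate v"
    using v cv by (simp add: Bv)
  also have "\<dots> = v \<bullet> (?B *\<^sub>v conjugate v)"
    by (rule symmetric_scalar_prod[OF B Bsym v(1) cv])
  also have "\<dots> = cnj c * (v \<bullet>c v)"
    using v cv by (simp add: Bcv)
  finally have "c = cnj c"
    using v conjugate_square_eq_0_vec[OF v(1)] by simp
  then have "c = complex_of_real (Re c)"
    by (simp add: complex_eq_iff)
  \<comment> \<open>Forming the characteristic polynomial commutes with the embedding of the reals,
    so a real root of the complex polynomial is a root of the one of \<open>A\<close>.\<close>
  then have "poly (char_poly ?B) (complex_of_real (Re c)) = 0"
    using c eigenvalue_root_char_poly[OF B] by simp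
  then have "poly (char_poly A) (Re c) = 0"
    by (simp add: of_real_hom.char_poly_hom[OF A] of_real_hom.poly_map_poly)
  then show ?thesis
    using eigenvalue_root_char_poly[OF A] by blast
qed

text \<open>Gram-Schmidt on a basis starting with \<open>v\<close> keeps \<open>v\<close> as first
  vector; \<open>c\<close> only accounts for the normalisation. This supplies the change of basis
  that splits off an eigenvector.\<close>

lemma orthogonal_matrix_with_first_column:
  fixes v :: "real vec"
  assumes v: "v \<in> carrier_vec n" and v0: "v \<noteq> 0\<^sub>v n" and n: "n > 0"
  shows "\<exists>W c. W \<in> carrier_mat n n \<and> W\<^sup>T * W = 1\<^sub>m n \<and> col W 0 = c \<cdot>\<^sub>v v"
proof -
  interpret cof_vec_space n "TYPE(real)" .
  define b where "b = basis_completion v"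
  define ws where "ws = gram_schmidt n b"
  note bc = basis_completion[OF v v0, folded b_def]
  obtain vs where bv: "b = v # vs"
    using bc(6,7) n by (cases b) auto
  note gs = gram_schmidt_result[OF bc(2,4,5) refl, folded ws_def]
  have hd: "hd ws = v"
    using gram_schmidt_hd[OF v, of vs] unfolding ws_def bv .
  have len: "length ws = n" using gs(4) bc(6) by simp
  have wsc: "ws ! i \<in> carrier_vec n" if "i < n" for i
    using gs(3) len that nth_mem by blast
  \<comment> \<open>Conjugation is trivial over the reals, so this is ordinary orthogonality; the
    case \<open>i = j\<close> says that no vector has norm zero, so normalising is possible.\<close>
  have orth: "ws ! i \<bullet> ws ! j = 0 \<longleftrightarrow> i \<noteq> j" if "i < n" "j < n" for i j
    using corthogonalD[OF gs(2), of i j] that len by simp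
  define c where "c i = 1 / sqrt (ws ! i \<bullet> ws ! i)" for i
  define W where "W = mat_of_cols n (map (\<lambda>i. c i \<cdot>\<^sub>v ws ! i) [0..<n])"
  have W: "W \<in> carrier_mat n n" unfolding W_def by (auto simp: mat_of_cols_def)
  have col: "col W i = c i \<cdot>\<^sub>v ws ! i" if "i < n" for i
    unfolding W_def using that wsc by (subst col_mat_of_cols) auto
  have "W\<^sup>T * W = 1\<^sub>m n"
  proof (rule eq_matI)
    fix i j assume "i < dim_row (1\<^sub>m n :: real mat)" "j < dim_col (1\<^sub>m n :: real mat)"
    then have i: "i < n" and j: "j < n" by auto
    have pos: "ws ! i \<bullet> ws ! i > 0"
      using orth[OF i i] conjugate_square_ge_0_vec[of "ws ! i"] by simp
    have "(W\<^sup>T * W) $$ (i, j) = col W i \<bullet> col W j"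
      using W i j by simp
    also have "\<dots> = c i * (c j * (ws ! i \<bullet> ws ! j))"
      using wsc[OF i] wsc[OF j] by (simp add: col i j)
    also have "\<dots> = 1\<^sub>m n $$ (i, j)"
      using i j orth[OF i j] pos by (cases "i = j") (auto simp: c_def divide_simps)
    finally show "(W\<^sup>T * W) $$ (i, j) = 1\<^sub>m n $$ (i, j)" .
  qed (use W in auto)
  moreover have "col W 0 = c 0 \<cdot>\<^sub>v v"
    using col[OF n] hd len n by (cases ws) auto
  ultimately show ?thesis using W by blast
qed

lemma mat_diag_mult_vec:
  assumes "y \<in> carrier_vec n"
  shows "mat_diag n d *\<^sub>v y = vec n (\<lambda>i. d i * y $ i :: 'a :: semiring_0)"
proof (rule eq_vecI)
  fix i assume "i < dim_vec (vec n (\<lambda>i. d i * y $ i))"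
  then have i: "i < n" by simp
  have "(mat_diag n d *\<^sub>v y) $ i = (\<Sum>j = 0..<n. (if i = j then d j else 0) * y $ j)"
    using assms i by (auto simp: mat_diag_def scalar_prod_def)
  also have "\<dots> = (\<Sum>j = 0..<n. if i = j then d j * y $ j else 0)"
    by (intro sum.cong) auto
  also have "\<dots> = d i * y $ i"
    using i by simp
  finally show "(mat_diag n d *\<^sub>v y) $ i = vec n (\<lambda>i. d i * y $ i) $ i"
    using i by simp
qed (auto simp: mat_diag_def)

text \<open>Deflation: an orthogonal \<open>W\<close> with first column along an eigenvector turns
  \<open>A\<close> into a block diagonal matrix with blocks \<open>e\<close> and a smaller symmetric
  \<open>C\<close>, to which the induction hypothesis applies.\<close>

theorem symmetric_orthogonally_diagonalizable:
  fixes A :: "real mat"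
  assumes "A \<in> carrier_mat n n" and "A\<^sup>T = A"
  shows "\<exists>U d. U \<in> carrier_mat n n \<and> U\<^sup>T * U = 1\<^sub>m n \<and> A * U = U * mat_diag n d"
  using assms
proof (induction n arbitrary: A)
  case 0
  then show ?case by (intro exI[of _ "1\<^sub>m 0"] exI[of _ "\<lambda>_. 0"] conjI) (auto intro!: eq_matI simp: mat_diag_def)
next
  case (Suc k)
  let ?n = "Suc k"
  note A = Suc.prems(1) and sym = Suc.prems(2)
  obtain e v where v: "v \<in> carrier_vec ?n" "v \<noteq> 0\<^sub>v ?n" and Av: "A *\<^sub>v v = e \<cdot>\<^sub>v v"
    using symmetric_has_real_eigenvalue[OF A sym] A unfolding eigenvalue_def eigenvector_def by auto
  obtain W c where W: "W \<in> carrier_mat ?n ?n" and WW: "W\<^sup>T * W = 1\<^sub>m ?n"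
    and W0: "col W 0 = c \<cdot>\<^sub>v v"
    using orthogonal_matrix_with_first_column[OF v] by auto
  have WT: "W\<^sup>T \<in> carrier_mat ?n ?n" using W by simp
  have WW': "W * W\<^sup>T = 1\<^sub>m ?n"
    by (rule mat_mult_left_right_inverse[OF WT W WW])
  define B where "B = W\<^sup>T * (A * W)"
  have B: "B \<in> carrier_mat ?n ?n" using W A unfolding B_def by auto
  have Bsym: "B\<^sup>T = B"
    unfolding B_def using A W WT sym
    by (simp add: transpose_mult[of _ ?n ?n _ ?n] assoc_mult_mat[of _ ?n ?n _ ?n _ ?n])
  have WB: "W * B = A * W"
    unfolding B_def assoc_mult_mat[OF W WT mult_carrier_mat[OF A W], symmetric] WW'
    using A W by simp
  \<comment> \<open>The eigenvalue equation is homogeneous, so it survives the scaling of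
    \<open>v\<close>; orthogonality of \<open>W\<close> then sends this column to the first unit
    vector.\<close>
  have Bcol: "col B 0 = e \<cdot>\<^sub>v unit_vec ?n 0"
  proof -
    have "A *\<^sub>v col W 0 = e \<cdot>\<^sub>v col W 0"
      using A v by (simp add: W0 Av mult_mat_vec[of _ ?n ?n] smult_smult_assoc mult.commute)
    have "col B 0 = W\<^sup>T *\<^sub>v (A *\<^sub>v col W 0)"
      unfolding B_def
      by (simp only: col_mult2[OF WT mult_carrier_mat[OF A W]] col_mult2[OF A W] zero_less_Suc)
    also have "\<dots> = e \<cdot>\<^sub>v (W\<^sup>T *\<^sub>v col W 0)"
      using \<open>A *\<^sub>v col W 0 = _\<close> W by (simp add: mult_mat_vec[OF WT col_carrier_vec[OF _ W]])
    also have "W\<^sup>T *\<^sub>v col W 0 = col (W\<^sup>T * W) 0"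
      by (rule col_mult2[OF WT W, symmetric]) simp
    finally show ?thesis by (simp add: WW)
  qed
  have Bi0: "B $$ (i, 0) = (if i = 0 then e else 0)" if "i < ?n" for i
    using arg_cong[OF Bcol, of "\<lambda>w. w $ i"] that B by auto
  \<comment> \<open>Symmetry clears the first row as well, which makes \<open>B\<close> block
    diagonal.\<close>
  have B0i: "B $$ (0, i) = (if i = 0 then e else 0)" if "i < ?n" for i
    using Bi0[OF that] arg_cong[OF Bsym, of "\<lambda>M. M $$ (0, i)"] that B by auto
  define C where "C = mat k k (\<lambda>(i, j). B $$ (Suc i, Suc j))"
  have C: "C \<in> carrier_mat k k" unfolding C_def by simp
  have "C\<^sup>T = C"
  proof (rule eq_matI)
    fix i j assume "i < dim_row C" "j < dim_col C"
    then show "C\<^sup>T $$ (i, j) = C $$ (i, j)"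
      using arg_cong[OF Bsym, of "\<lambda>M. M $$ (Suc i, Suc j)"] B unfolding C_def by auto
  qed (auto simp: C_def)
  from Suc.IH[OF C this] obtain V d where V: "V \<in> carrier_mat k k" and VV: "V\<^sup>T * V = 1\<^sub>m k"
    and CV: "C * V = V * mat_diag k d" by blast
  let ?E = "mat 1 1 (\<lambda>_. e)"
  \<comment> \<open>\<open>?f a M\<close> is block diagonal with blocks \<open>a\<close> and
    \<open>M\<close>. Such matrices multiply blockwise, so \<open>X\<close> inherits from
    \<open>V\<close> both orthogonality and the diagonalisation.\<close>
  let ?f = "\<lambda>a M. four_block_mat a (0\<^sub>m 1 k) (0\<^sub>m k 1) M"
  have Bf: "B = ?f ?E C"
    using B Bi0 B0i by (intro eq_matI) (auto simp: C_def)
  define X where "X = ?f (1\<^sub>m 1) V"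
  have X: "X \<in> carrier_mat ?n ?n" unfolding X_def using V by auto
  have f_mult: "?f a M * ?f b N = ?f (a * b) (M * N)"
    if "a \<in> carrier_mat 1 1" "b \<in> carrier_mat 1 1" "M \<in> carrier_mat k k" "N \<in> carrier_mat k k"
    for a b M N :: "real mat"
    using that by (subst mult_four_block_mat[of _ 1 1 _ k _ k _ _ 1 _ k]) auto
  define g where "g = case_nat e d"
  have D: "mat_diag ?n g = ?f ?E (mat_diag k d)"
    by (rule eq_matI) (auto simp: mat_diag_def g_def split: nat.split)
  have XX: "X\<^sup>T * X = 1\<^sub>m ?n"
  proof -
    have "X\<^sup>T = ?f (1\<^sub>m 1) V\<^sup>T"
      unfolding X_def using V by (subst transpose_four_block_mat[of _ 1 1 _ k _ k]) auto
    then have "X\<^sup>T * X = ?f (1\<^sub>m 1 * 1\<^sub>m 1) (V\<^sup>T * V)"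
      unfolding X_def using V f_mult[of "1\<^sub>m 1" "1\<^sub>m 1" "V\<^sup>T" V] by simp
    then show ?thesis by (simp add: VV)
  qed
  have BX: "B * X = X * mat_diag ?n g"
  proof -
    have "?f ?E C * ?f (1\<^sub>m 1) V = ?f (?E * 1\<^sub>m 1) (C * V)"
      using C V by (intro f_mult) auto
    also have "\<dots> = ?f (1\<^sub>m 1 * ?E) (V * mat_diag k d)"
      by (simp add: CV)
    also have "\<dots> = ?f (1\<^sub>m 1) V * ?f ?E (mat_diag k d)"
      using V by (intro f_mult[symmetric]) auto
    finally show ?thesis by (simp only: D Bf X_def)
  qed
  show ?case
  proof (intro exI conjI)
    show "W * X \<in> carrier_mat ?n ?n" using W X by simp
    have "(W * X)\<^sup>T * (W * X) = X\<^sup>T * ((W\<^sup>T * W) * X)"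
      using W X by (simp add: transpose_mult[of _ ?n ?n _ ?n] assoc_mult_mat[of _ ?n ?n _ ?n _ ?n])
    then show "(W * X)\<^sup>T * (W * X) = 1\<^sub>m ?n" using X by (simp add: WW XX)
    have "A * (W * X) = (A * W) * X"
      using A W X by simp
    also have "\<dots> = W * (B * X)"
      unfolding WB[symmetric] using B W X by simp
    also have "\<dots> = W * X * mat_diag ?n g"
      unfolding BX using W X by (simp add: assoc_mult_mat[of _ ?n ?n _ ?n _ ?n])
    finally show "A * (W * X) = W * X * mat_diag ?n g" .
  qed
qed


section \<open>Quadratic forms through the spectrum, and positive definiteness\<close>

lemma diagonalization_entry_in_spectrum:
  fixes A :: "'a :: field mat"
  assumes A: "A \<in> carrier_mat n n" and U: "U \<in> carrier_mat n n" and UU: "U\<^sup>T * U = 1\<^sub>m n"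
    and AU: "A * U = U * mat_diag n d" and i: "i < n"
  shows "d i \<in> spectrum A"
proof -
  have "A *\<^sub>v col U i = col (A * U) i"
    by (rule col_mult2[OF A U i, symmetric])
  also have "\<dots> = d i \<cdot>\<^sub>v col U i"
    unfolding AU using U i by (intro eq_vecI) (auto simp: mat_diag_mult_right[OF U])
  finally have "A *\<^sub>v col U i = d i \<cdot>\<^sub>v col U i" .
  moreover have "col U i \<noteq> 0\<^sub>v n"
  proof
    assume "col U i = 0\<^sub>v n"
    then have "(U\<^sup>T * U) $$ (i, i) = 0" using U i by simp
    then show False using i by (simp add: UU)
  qed
  ultimately have "eigenvector A (col U i) (d i)"
    unfolding eigenvector_def using A U i by auto
  then show ?thesis unfolding spectrum_def eigenvalue_def by auto
qed

text \<open>In the coordinates \<open>y = U\<^sup>T *\<^sub>v x\<close> the matrix acts diagonally,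
  and the weights are the squares of the entries of \<open>y\<close>. The same weights serve every
  \<open>k\<close>, so inequalities between polynomials in \<open>A\<close> reduce to scalar ones on
  the spectrum.\<close>

lemma symmetric_power_form_expansion:
  fixes A :: "real mat"
  assumes A: "A \<in> carrier_mat n n" and sym: "A\<^sup>T = A" and x: "x \<in> carrier_vec n"
  shows "\<exists>d w. (\<forall>i<n. d i \<in> spectrum A \<and> w i \<ge> 0) \<and>
    (\<forall>k. x \<bullet> (((*\<^sub>v) A ^^ k) x) = (\<Sum>i<n. d i ^ k * w i))"
proof -
  obtain U d where U: "U \<in> carrier_mat n n" and UU: "U\<^sup>T * U = 1\<^sub>m n"
    and AU: "A * U = U * mat_diag n d"
    using symmetric_orthogonally_diagonalizable[OF A sym] by blast
  have UT: "U\<^sup>T \<in> carrier_mat n n" using U by simp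
  have UU': "U * U\<^sup>T = 1\<^sub>m n" by (rule mat_mult_left_right_inverse[OF UT U UU])
  define y where "y = U\<^sup>T *\<^sub>v x"
  have y: "y \<in> carrier_vec n" unfolding y_def using UT x by simp
  have xy: "x = U *\<^sub>v y"
    unfolding y_def using U UT x UU' by (simp flip: assoc_mult_mat_vec[of _ n n _ n])
  have pow: "((*\<^sub>v) A ^^ k) x = U *\<^sub>v vec n (\<lambda>i. d i ^ k * y $ i)" for k
  proof (induction k)
    case 0
    have "vec n (\<lambda>i. y $ i) = y" using y by auto
    then show ?case using xy by simp
  next
    case (Suc k)
    let ?z = "vec n (\<lambda>i. d i ^ k * y $ i)"
    have "A *\<^sub>v (U *\<^sub>v ?z) = U *\<^sub>v (mat_diag n d *\<^sub>v ?z)"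
      using A U AU by (simp flip: assoc_mult_mat_vec[of _ n n _ n])
    also have "mat_diag n d *\<^sub>v ?z = vec n (\<lambda>i. d i ^ Suc k * y $ i)"
      by (subst mat_diag_mult_vec) (auto simp: mult.assoc)
    finally show ?case using Suc by simp
  qed
  have "x \<bullet> (((*\<^sub>v) A ^^ k) x) = (\<Sum>i<n. d i ^ k * (y $ i)\<^sup>2)" for k
  proof -
    let ?z = "vec n (\<lambda>i. d i ^ k * y $ i)"
    have "x \<bullet> (((*\<^sub>v) A ^^ k) x) = (U\<^sup>T *\<^sub>v x) \<bullet> ?z"
      unfolding pow using transpose_vec_mult_scalar[OF U _ x, of ?z] by simp
    also have "\<dots> = (\<Sum>i<n. d i ^ k * (y $ i)\<^sup>2)"
      unfolding y_def[symmetric] scalar_prod_def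
      by (auto intro!: sum.cong simp: power2_eq_square atLeast0LessThan)
    finally show ?thesis .
  qed
  then show ?thesis
    using diagonalization_entry_in_spectrum[OF A U UU AU]
    by (intro exI[of _ d] exI[of _ "\<lambda>i. (y $ i)\<^sup>2"]) simp
qed

lemma pos_def_spectrum_pos:
  assumes A: "A \<in> carrier_mat n n" and pd: "pos_def_mat A" and e: "e \<in> spectrum A"
  shows "e > 0"
proof -
  obtain v where v: "v \<in> carrier_vec n" "v \<noteq> 0\<^sub>v n" and Av: "A *\<^sub>v v = e \<cdot>\<^sub>v v"
    using e A unfolding spectrum_def eigenvalue_def eigenvector_def by auto
  have "0 < v \<bullet> (A *\<^sub>v v)"
    using pd v A unfolding pos_def_mat_def by auto
  also have "v \<bullet> (A *\<^sub>v v) = e * (v \<bullet> v)"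
    using v by (simp add: Av)
  finally show ?thesis
    using conjugate_square_ge_0_vec[of v] by (simp add: zero_less_mult_iff)
qed

lemma pos_def_form_nonneg:
  assumes "A \<in> carrier_mat n n" "pos_def_mat A" "x \<in> carrier_vec n"
  shows "x \<bullet> (A *\<^sub>v x) \<ge> 0"
  using assms unfolding pos_def_mat_def by (cases "x = 0\<^sub>v n") (auto intro: less_imp_le)

text \<open>Take \<open>G = U * S\<close> with \<open>S\<close> the square root of the diagonal
  part. The factorization later allows a nonsymmetric product with \<open>A\<close> to be traded for
  a symmetric matrix.\<close>

lemma pos_def_factorization:
  assumes A: "A \<in> carrier_mat n n" and sym: "A\<^sup>T = A" and pd: "pos_def_mat A"
  shows "\<exists>G \<in> carrier_mat n n. G * G\<^sup>T = A"
proof -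
  obtain U d where U: "U \<in> carrier_mat n n" and UU: "U\<^sup>T * U = 1\<^sub>m n"
    and AU: "A * U = U * mat_diag n d"
    using symmetric_orthogonally_diagonalizable[OF A sym] by blast
  have UT: "U\<^sup>T \<in> carrier_mat n n" using U by simp
  have UU': "U * U\<^sup>T = 1\<^sub>m n" by (rule mat_mult_left_right_inverse[OF UT U UU])
  define S where "S = mat_diag n (\<lambda>i. sqrt (d i))"
  have S: "S \<in> carrier_mat n n" and ST: "S\<^sup>T = S"
    unfolding S_def by (auto simp: mat_diag_def intro!: eq_matI)
  \<comment> \<open>\<open>sqrt t * sqrt t\<close> is the absolute value of \<open>t\<close>, so
    positivity of the eigenvalues is what recovers \<open>d i\<close>.\<close>
  have SS: "S * S = mat_diag n d"
  proof -
    have "d i > 0" if "i < n" for i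
      using pos_def_spectrum_pos[OF A pd] diagonalization_entry_in_spectrum[OF A U UU AU that] .
    then show ?thesis
      unfolding S_def mat_diag_diag by (intro eq_matI) (auto simp: mat_diag_def abs_of_pos)
  qed
  have "(U * S) * (U * S)\<^sup>T = U * ((S * S) * U\<^sup>T)"
    using U S UT ST by (simp add: transpose_mult[of _ n n _ n] assoc_mult_mat[of _ n n _ n _ n])
  also have "\<dots> = (A * U) * U\<^sup>T"
    unfolding SS AU using U UT by (simp add: assoc_mult_mat[of _ n n _ n _ n])
  also have "\<dots> = A"
    using A U UT UU' by (simp add: assoc_mult_mat[of _ n n _ n _ n])
  finally show ?thesis using U S by (intro bexI[of _ "U * S"]) auto
qed

text \<open>Sum the scalar inequality \<open>(M - t) * (t - m) * t \<ge> 0\<close> over the spectral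
  expansion at \<open>x\<close>; the last factor is nonnegative because
  \<open>t \<ge> m \<ge> 0\<close>.\<close>

lemma spectral_interval_form_ineq:
  fixes A :: "real mat"
  assumes A: "A \<in> carrier_mat n n" and sym: "A\<^sup>T = A"
    and spec: "spectrum A \<subseteq> {m..M}" and m: "m \<ge> 0" and x: "x \<in> carrier_vec n"
  shows "m * M * (x \<bullet> (A *\<^sub>v x)) + (A *\<^sub>v x) \<bullet> (A *\<^sub>v (A *\<^sub>v x))
    \<le> (m + M) * ((A *\<^sub>v x) \<bullet> (A *\<^sub>v x))"
proof -
  obtain d w where dw: "\<And>i. i < n \<Longrightarrow> d i \<in> spectrum A \<and> w i \<ge> 0"
    and pow: "\<And>k. x \<bullet> (((*\<^sub>v) A ^^ k) x) = (\<Sum>i<n. d i ^ k * w i)"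
    using symmetric_power_form_expansion[OF A sym x] by auto
  have 1: "x \<bullet> (A *\<^sub>v x) = (\<Sum>i<n. d i * w i)"
    using pow[of 1] by simp
  \<comment> \<open>Symmetry moves one factor \<open>A\<close> to the left, so this form and the
    next are those of the second and third powers of \<open>A\<close> at \<open>x\<close>.\<close>
  have 2: "(A *\<^sub>v x) \<bullet> (A *\<^sub>v x) = (\<Sum>i<n. d i ^ 2 * w i)"
    using pow[of 2] symmetric_scalar_prod[OF A sym x, of "A *\<^sub>v x"] A x
    by (simp add: numeral_2_eq_2)
  have 3: "(A *\<^sub>v x) \<bullet> (A *\<^sub>v (A *\<^sub>v x)) = (\<Sum>i<n. d i ^ 3 * w i)"
    using pow[of 3] symmetric_scalar_prod[OF A sym x, of "A *\<^sub>v (A *\<^sub>v x)"] A x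
    by (simp add: numeral_3_eq_3)
  have "0 \<le> (\<Sum>i<n. (M - d i) * (d i - m) * d i * w i)"
  proof (rule sum_nonneg)
    fix i assume "i \<in> {..<n}"
    then have "m \<le> d i" "d i \<le> M" "0 \<le> w i" using dw[of i] spec by auto
    then show "0 \<le> (M - d i) * (d i - m) * d i * w i" using m by auto
  qed
  also have "\<dots> = (\<Sum>i<n. (m + M) * (d i ^ 2 * w i) - d i ^ 3 * w i - m * M * (d i * w i))"
    by (intro sum.cong) (auto simp: algebra_simps power2_eq_square power3_eq_cube)
  also have "\<dots> = (m + M) * ((A *\<^sub>v x) \<bullet> (A *\<^sub>v x)) - (A *\<^sub>v x) \<bullet> (A *\<^sub>v (A *\<^sub>v x))
      - m * M * (x \<bullet> (A *\<^sub>v x))"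
    unfolding 1 2 3 by (simp add: sum_subtractf sum_distrib_left)
  finally show ?thesis by simp
qed

lemma symmetric_form_diff:
  fixes A :: "'a :: field mat"
  assumes A: "A \<in> carrier_mat n n" and sym: "A\<^sup>T = A"
    and x: "x \<in> carrier_vec n" and y: "y \<in> carrier_vec n"
  shows "(x - c \<cdot>\<^sub>v y) \<bullet> (A *\<^sub>v (x - c \<cdot>\<^sub>v y))
    = x \<bullet> (A *\<^sub>v x) - 2 * c * (x \<bullet> (A *\<^sub>v y)) + c * c * (y \<bullet> (A *\<^sub>v y))"
proof -
  have car: "A *\<^sub>v x \<in> carrier_vec n" "A *\<^sub>v y \<in> carrier_vec n" using A x y by auto
  have "A *\<^sub>v (x - c \<cdot>\<^sub>v y) = A *\<^sub>v x - c \<cdot>\<^sub>v (A *\<^sub>v y)"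
    using A x y by (simp add: mult_minus_distrib_mat_vec[of _ n n] mult_mat_vec[of _ n n])
  moreover have "y \<bullet> (A *\<^sub>v x) = x \<bullet> (A *\<^sub>v y)"
    using symmetric_scalar_prod[OF A sym y x] comm_scalar_prod[OF x car(2)] by simp
  ultimately show ?thesis
    using x y car
    by (simp add: minus_scalar_prod_distrib[of _ n] scalar_prod_minus_distrib[of _ n] algebra_simps)
qed

section \<open>Nonzero eigenvalues of the preconditioned matrix\<close>

text \<open>Here \<open>R\<close> is the inverse of \<open>A\<close> and \<open>P\<close> an
  orthogonal projection. The lower bound serves the denominator of the effective condition number,
  the upper bound its numerator.\<close>

lemma projected_inverse_eigenvalue_bounds:
  fixes A :: "real mat"
  assumes A: "A \<in> carrier_mat n n" and sym: "A\<^sup>T = A" and pd: "pos_def_mat A"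
    and R: "R \<in> carrier_mat n n" and AR: "A * R = 1\<^sub>m n"
    and P: "P \<in> carrier_mat n n" and Psym: "P\<^sup>T = P" and PP: "P * P = P"
    and spec: "spectrum A \<subseteq> {m..M}" and m: "m > 0" and mM: "m \<le> M"
    and ev: "eigenvalue (P * R * P * A) l" and l0: "l \<noteq> 0"
  shows "1 \<le> l" and "l \<le> (m + M)\<^sup>2 / (4 * m * M)"
proof -
  obtain v where v: "v \<in> carrier_vec n" "v \<noteq> 0\<^sub>v n" and Bv: "(P * R * P * A) *\<^sub>v v = l \<cdot>\<^sub>v v"
    using ev P A unfolding eigenvalue_def eigenvector_def by auto
  define u where "u = P *\<^sub>v (A *\<^sub>v v)"
  define x where "x = R *\<^sub>v u"
  define q where "q = v \<bullet> (A *\<^sub>v v)"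
  have Av: "A *\<^sub>v v \<in> carrier_vec n" using A v by auto
  have u: "u \<in> carrier_vec n" and x: "x \<in> carrier_vec n" unfolding u_def x_def using P R Av by auto
  have q: "q > 0" unfolding q_def using pd v A unfolding pos_def_mat_def by auto
  have Pidem: "P *\<^sub>v (P *\<^sub>v y) = P *\<^sub>v y" if "y \<in> carrier_vec n" for y
    using P that PP by (simp flip: assoc_mult_mat_vec[of _ n n _ n])
  have Px: "P *\<^sub>v x = l \<cdot>\<^sub>v v"
    using Bv P R A v unfolding x_def u_def by (simp add: assoc_mult_mat_vec[of _ n n _ n])
  \<comment> \<open>\<open>l \<cdot>\<^sub>v v = P *\<^sub>v x\<close> lies in the range of
    \<open>P\<close>, and \<open>l\<close> can be cancelled.\<close>
  have Pv: "P *\<^sub>v v = v"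
  proof -
    have "l \<cdot>\<^sub>v (P *\<^sub>v v) = P *\<^sub>v (P *\<^sub>v x)"
      unfolding Px using P v by (simp add: mult_mat_vec)
    also have "\<dots> = l \<cdot>\<^sub>v v" using Pidem[OF x] Px by simp
    finally have "inverse l \<cdot>\<^sub>v (l \<cdot>\<^sub>v (P *\<^sub>v v)) = inverse l \<cdot>\<^sub>v (l \<cdot>\<^sub>v v)" by simp
    then show ?thesis using l0 by (simp add: smult_smult_assoc)
  qed
  have Pu: "P *\<^sub>v u = u" unfolding u_def using Pidem Av by simp
  have Ax: "A *\<^sub>v x = u"
    unfolding x_def using A R u AR by (simp flip: assoc_mult_mat_vec[of _ n n _ n])
  have Padj: "y \<bullet> u = (P *\<^sub>v y) \<bullet> (A *\<^sub>v v)" if "y \<in> carrier_vec n" for y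
    unfolding u_def using symmetric_scalar_prod[OF P Psym that Av] by simp
  have xAx: "x \<bullet> (A *\<^sub>v x) = l * q"
    unfolding Ax Padj[OF x] Px q_def using v Av by simp
  have xAv: "x \<bullet> (A *\<^sub>v v) = q"
    using symmetric_scalar_prod[OF A sym x v(1)] comm_scalar_prod[OF u v(1)] Padj[OF v(1)]
    by (simp add: Ax Pv q_def)
  have uAv: "u \<bullet> (A *\<^sub>v v) = u \<bullet> u"
    using Padj[OF u] by (simp add: Pu)

  \<comment> \<open>Cauchy-Schwarz takes the form of nonnegativity at \<open>x - v\<close>, where
    the expansion is \<open>l * q - 2 * q + q\<close>.\<close>
  have "0 \<le> (x - 1 \<cdot>\<^sub>v v) \<bullet> (A *\<^sub>v (x - 1 \<cdot>\<^sub>v v))"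
    using x v by (intro pos_def_form_nonneg[OF A pd]) auto
  also have "\<dots> = (l - 1) * q"
    unfolding symmetric_form_diff[OF A sym x v(1)] xAx xAv q_def[symmetric]
    by (simp add: algebra_simps)
  finally show "1 \<le> l" using q by (simp add: zero_le_mult_iff)

  \<comment> \<open>This value makes the cross term \<open>2 * h * (u \<bullet> u)\<close> equal to
    the right-hand side of the spectral inequality at \<open>x\<close>; since
    \<open>A *\<^sub>v x = u\<close>, adding the two inequalities also cancels
    \<open>u \<bullet> (A *\<^sub>v u)\<close>.\<close>
  define h where "h = (m + M) / 2"
  have "0 \<le> (u - h \<cdot>\<^sub>v v) \<bullet> (A *\<^sub>v (u - h \<cdot>\<^sub>v v))"
    using u v by (intro pos_def_form_nonneg[OF A pd]) auto
  also have "\<dots> = u \<bullet> (A *\<^sub>v u) - (m + M) * (u \<bullet> u) + h * h * q"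
    unfolding symmetric_form_diff[OF A sym u v(1)] uAv q_def[symmetric] by (simp add: h_def)
  finally have "m * M * (l * q) \<le> h * h * q"
    using spectral_interval_form_ineq[OF A sym spec _ x] m unfolding Ax[symmetric] xAx[symmetric]
    by simp
  then have "m * M * l \<le> h * h"
    using q by (simp add: mult.assoc[symmetric])
  then show "l \<le> (m + M)\<^sup>2 / (4 * m * M)"
    using m mM by (simp add: h_def field_simps power2_eq_square)
qed

text \<open>With \<open>N = P * R * P\<close>, the symmetric matrix \<open>G\<^sup>T * N * G\<close>
  has a positive form value at some vector, hence a nonzero eigenvalue, which transfers to
  \<open>N * G * G\<^sup>T = N * A\<close>.\<close>

lemma projected_inverse_nonzero_eigenvalue:
  fixes A :: "real mat"
  assumes A: "A \<in> carrier_mat n n" and sym: "A\<^sup>T = A" and pd: "pos_def_mat A"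
    and R: "R \<in> carrier_mat n n" and AR: "A * R = 1\<^sub>m n"
    and P: "P \<in> carrier_mat n n" and Psym: "P\<^sup>T = P"
    and w: "w \<in> carrier_vec n" "w \<noteq> 0\<^sub>v n" and Pw: "P *\<^sub>v w = w"
  shows "\<exists>l. l \<noteq> 0 \<and> eigenvalue (P * R * P * A) l"
proof -
  obtain G where G: "G \<in> carrier_mat n n" and GG: "G * G\<^sup>T = A"
    using pos_def_factorization[OF A sym pd] by blast
  have GT: "G\<^sup>T \<in> carrier_mat n n" and RT: "R\<^sup>T \<in> carrier_mat n n" using G R by auto
  have "R\<^sup>T * A = 1\<^sub>m n"
    using arg_cong[OF AR, of transpose_mat] A R sym by (simp add: transpose_mult[of _ n n _ n])
  \<comment> \<open>A left and a right inverse of \<open>A\<close> coincide: bracket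
    \<open>R\<^sup>T * A * R\<close> both ways.\<close>
  then have Rsym: "R\<^sup>T = R"
    using AR A R RT assoc_mult_mat[OF RT A R] by simp
  define N where "N = P * (R * P)"
  have N: "N \<in> carrier_mat n n" unfolding N_def using P R by simp
  have Nsym: "N\<^sup>T = N"
    unfolding N_def using P R Psym Rsym
    by (simp add: transpose_mult[of _ n n _ n] assoc_mult_mat[of _ n n _ n _ n])
  \<comment> \<open>\<open>S\<close> is symmetric and has the same nonzero eigenvalues as \<open>N A = N G G\<^sup>T\<close>.\<close>
  define S where "S = G\<^sup>T * (N * G)"
  have S: "S \<in> carrier_mat n n" unfolding S_def using G N by auto
  have Ssym: "S\<^sup>T = S"
    unfolding S_def using G N GT Nsym
    by (simp add: transpose_mult[of _ n n _ n] assoc_mult_mat[of _ n n _ n _ n])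
  have Sz: "S *\<^sub>v z = G\<^sup>T *\<^sub>v (N *\<^sub>v (G *\<^sub>v z))" if "z \<in> carrier_vec n" for z
    unfolding S_def using G N GT that by (simp add: assoc_mult_mat_vec[of _ n n _ n])
  \<comment> \<open>Chosen so that \<open>G *\<^sub>v y = A *\<^sub>v x = w\<close>. As
    \<open>P\<close> fixes \<open>w\<close>, the form of \<open>S\<close> at \<open>y\<close> then
    collapses to \<open>x \<bullet> (A *\<^sub>v x)\<close>, which is positive.\<close>
  define x where "x = R *\<^sub>v w"
  define y where "y = G\<^sup>T *\<^sub>v x"
  have x: "x \<in> carrier_vec n" and y: "y \<in> carrier_vec n"
    unfolding x_def y_def using R G w by auto
  have Ax: "A *\<^sub>v x = w"
    unfolding x_def using A R w AR by (simp flip: assoc_mult_mat_vec[of _ n n _ n])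
  have Gy: "G *\<^sub>v y = w"
    unfolding y_def using G GT x GG Ax by (simp flip: assoc_mult_mat_vec[of _ n n _ n])
  have "x \<noteq> 0\<^sub>v n" using Ax w A by auto
  have "y \<bullet> (S *\<^sub>v y) = w \<bullet> (N *\<^sub>v w)"
    using transpose_vec_mult_scalar[OF GT _ y, of "N *\<^sub>v w"] N w Sz[OF y] by (simp add: Gy)
  also have "N *\<^sub>v w = P *\<^sub>v x"
    unfolding N_def x_def using P R w Pw by (simp add: assoc_mult_mat_vec[of _ n n _ n])
  also have "w \<bullet> (P *\<^sub>v x) = w \<bullet> x"
    using symmetric_scalar_prod[OF P Psym w(1) x] by (simp add: Pw)
  also have "\<dots> = x \<bullet> (A *\<^sub>v x)"
    using comm_scalar_prod[OF w(1) x] by (simp add: Ax)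
  also have "\<dots> > 0"
    using pd A x \<open>x \<noteq> 0\<^sub>v n\<close> unfolding pos_def_mat_def by auto
  finally have pos: "y \<bullet> (S *\<^sub>v y) > 0" .
  obtain d c where dc: "\<And>i. i < n \<Longrightarrow> d i \<in> spectrum S"
    and pow: "\<And>k. y \<bullet> (((*\<^sub>v) S ^^ k) y) = (\<Sum>i<n. d i ^ k * c i)"
    using symmetric_power_form_expansion[OF S Ssym y] by auto
  \<comment> \<open>The case \<open>k = 1\<close> of the expansion is the positive form value, so
    not all eigenvalues \<open>d i\<close> can vanish.\<close>
  have "(\<Sum>i<n. d i * c i) \<noteq> 0" using pow[of 1] pos by simp
  then have "\<exists>i\<in>{..<n}. d i * c i \<noteq> 0"
    by (meson sum.neutral)
  then obtain i where i: "i < n" "d i \<noteq> 0" by auto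
  define l where "l = d i"
  have l0: "l \<noteq> 0" using i by (simp add: l_def)
  obtain z where z: "z \<in> carrier_vec n" "z \<noteq> 0\<^sub>v n" and ev: "S *\<^sub>v z = l \<cdot>\<^sub>v z"
    using dc[OF i(1)] S unfolding spectrum_def eigenvalue_def eigenvector_def l_def by auto
  \<comment> \<open>The usual passage from an eigenvector of a product \<open>X * Y\<close> to one
    of \<open>Y * X\<close>, with \<open>X = G\<^sup>T\<close> and \<open>Y = N * G\<close>;
    \<open>l \<noteq> 0\<close> keeps \<open>v\<close> nonzero.\<close>
  define v where "v = N *\<^sub>v (G *\<^sub>v z)"
  have v: "v \<in> carrier_vec n" unfolding v_def using N G z by simp
  have GTv: "G\<^sup>T *\<^sub>v v = l \<cdot>\<^sub>v z"
    unfolding v_def using Sz[OF z(1)] ev by simp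
  have "v \<noteq> 0\<^sub>v n"
  proof
    assume "v = 0\<^sub>v n"
    moreover have "G\<^sup>T *\<^sub>v 0\<^sub>v n = 0\<^sub>v n" using GT by (intro eq_vecI) auto
    ultimately have "l \<cdot>\<^sub>v z = 0\<^sub>v n" using GTv by simp
    then have "inverse l \<cdot>\<^sub>v (l \<cdot>\<^sub>v z) = 0\<^sub>v n" by (auto intro: eq_vecI)
    then show False using l0 z by (simp add: smult_smult_assoc)
  qed
  moreover have "(P * R * P * A) *\<^sub>v v = l \<cdot>\<^sub>v v"
  proof -
    have "(P * R * P * A) *\<^sub>v v = N *\<^sub>v (G *\<^sub>v (G\<^sup>T *\<^sub>v v))"
      unfolding N_def GG[symmetric] using P R G GT v
      by (simp add: assoc_mult_mat_vec[of _ n n _ n] assoc_mult_mat[of _ n n _ n _ n])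
    also have "\<dots> = l \<cdot>\<^sub>v v"
      unfolding GTv unfolding v_def using N G z by (simp add: mult_mat_vec[of _ n n])
    finally show ?thesis .
  qed
  ultimately have "eigenvector (P * R * P * A) v l"
    unfolding eigenvector_def using P A v by auto
  then show ?thesis using l0 unfolding eigenvalue_def by blast
qed

section \<open>Invertibility of \<open>A\<close> and the final estimate\<close>

text \<open>A kernel vector would make the form vanish, so the determinant is nonzero and
  \<open>mat_inverse A\<close> is a \<open>Some\<close>.\<close>

lemma pos_def_mat_inverse:
  assumes A: "A \<in> carrier_mat n n" and pd: "pos_def_mat A"
  shows "the (mat_inverse A) \<in> carrier_mat n n" and "A * the (mat_inverse A) = 1\<^sub>m n"
proof -
  have "det A \<noteq> 0"
  proof
    assume "det A = 0"
    then obtain v where "v \<in> carrier_vec n" "v \<noteq> 0\<^sub>v n" "A *\<^sub>v v = 0\<^sub>v n"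
      using det_0_iff_vec_prod_zero[OF A] by auto
    then show False using pd A unfolding pos_def_mat_def by force
  qed
  then have "A \<in> Units (ring_mat TYPE(real) n ())"
    by (rule det_non_zero_imp_unit[OF A])
  then obtain R where R: "mat_inverse A = Some R"
    using mat_inverse(1)[OF A, where b = "()"] by (cases "mat_inverse A") auto
  from mat_inverse(2)[OF A R] R
  show "the (mat_inverse A) \<in> carrier_mat n n" "A * the (mat_inverse A) = 1\<^sub>m n" by auto
qed

theorem theorem5p8:
  fixes A :: "real mat" and n :: nat and F Act :: "nat set"
  assumes "A \<in> carrier_mat n n"
    and "A\<^sup>T = A"
    and "pos_def_mat A"
    and "F \<union> Act = {0..<n}"
    and "F \<inter> Act = {}"
    and "F \<noteq> {}"
  shows "eff_cond (face_precond n F A * A) \<le> (spectral_cond A + 1)^2 / (4 * spectral_cond A)"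
proof -
  note A = assms(1) and sym = assms(2) and pd = assms(3)
  define R where "R = the (mat_inverse A)"
  define P where "P = coord_proj n F"
  define B where "B = face_precond n F A * A"
  have B_eq: "B = P * R * P * A"
    unfolding B_def face_precond_def P_def R_def ..
  have R: "R \<in> carrier_mat n n" and AR: "A * R = 1\<^sub>m n"
    unfolding R_def using pos_def_mat_inverse[OF A pd] .
  have P: "P \<in> carrier_mat n n" and Psym: "P\<^sup>T = P" and PP: "P * P = P"
    unfolding P_def coord_proj_def mat_diag_diag by (auto simp: mat_diag_def intro!: eq_matI)
  have B: "B \<in> carrier_mat n n" unfolding B_eq using P A by auto
  \<comment> \<open>An index in the face provides a unit vector fixed by \<open>P\<close>, the
    witness for a nonzero eigenvalue of \<open>B\<close>.\<close>
  obtain i where iF: "i \<in> F" and i: "i < n" using assms(4,6) atLeastLessThan_iff by blast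
  have Pi: "P *\<^sub>v unit_vec n i = unit_vec n i"
    unfolding P_def coord_proj_def using iF
    by (subst mat_diag_mult_vec) (auto simp: unit_vec_def)
  define m M where "m = Min (spectrum A)" and "M = Max (spectrum A)"
  have finA: "finite (spectrum A)" and finB: "finite (spectrum B)"
    using card_finite_spectrum(1) A B by auto
  have neA: "spectrum A \<noteq> {}"
    using symmetric_has_real_eigenvalue[OF A sym] i unfolding spectrum_def by auto
  have spec: "spectrum A \<subseteq> {m..M}" unfolding m_def M_def using finA by auto
  have mM: "m \<le> M" using spec neA by fastforce
  have m: "m > 0"
    using pos_def_spectrum_pos[OF A pd Min_in[OF finA neA]] unfolding m_def .
  let ?K = "(m + M)\<^sup>2 / (4 * m * M)"
  have bounds: "1 \<le> l \<and> l \<le> ?K" if "l \<in> spectrum B - {0}" for l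
    using projected_inverse_eigenvalue_bounds[OF A sym pd R AR P Psym PP spec m mM, of l] that
    unfolding B_eq spectrum_def by auto
  \<comment> \<open>needed because \<open>Min {}\<close> is unspecified\<close>
  have "unit_vec n i \<noteq> (0\<^sub>v n :: real vec)" using i by simp
  then have ne: "spectrum B - {0} \<noteq> {}"
    using projected_inverse_nonzero_eigenvalue[OF A sym pd R AR P Psym _ _ Pi]
    unfolding B_eq spectrum_def by auto
  \<comment> \<open>The value 0 may lie in \<open>spectrum B\<close> and is not covered by
    \<open>bounds\<close>; \<open>1 \<le> ?K\<close> takes care of it in the estimate of the
    maximum.\<close>
  have K: "1 \<le> ?K" using bounds ne by fastforce
  have Min: "1 \<le> Min (spectrum B - {0})"
    using bounds finB ne by simp
  have Max: "Max (spectrum B) \<le> ?K"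
    using finB ne bounds K by (subst Max_le_iff) force+
  have "Max (spectrum B) / Min (spectrum B - {0}) \<le> ?K / 1"
    using Min Max K by (intro frac_le) auto
  \<comment> \<open>Divide numerator and denominator by the square of \<open>m\<close>;
    \<open>M / m\<close> is the condition number of \<open>A\<close>.\<close>
  also have "?K / 1 = (M / m + 1)\<^sup>2 / (4 * (M / m))"
    using m mM by (simp add: field_simps power2_eq_square)
  finally show ?thesis
    unfolding eff_cond_def spectral_cond_def B_def[symmetric] m_def[symmetric] M_def[symmetric] .
qed

end
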